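(* Let $\mathcal{W}$ be a finite set, let $\mathbf{P}_t=(P_{t,w})_{w\in\mathcal{W}}$ be a probability distribution on $\mathcal{W}$, let $\mathcal{G}\subseteq\mathcal{W}$, and put $P_{t,\mathcal{G}}:=\sum_{w'\in\mathcal{G}}P_{t,w'}$. Assume $P_{t,\mathcal{G}}>0$. Let $\zeta_t\sim U[0,1]$ and let $w_t$ be the token produced by the watermarked decoder (defined in the context) from $\mathbf{P}_t$, $\mathcal{G}$ and $\zeta_t$. Then the conditional distribution of $\zeta_t$ given the event $\{w_t\in\mathcal{G}\}$ (for the given $\mathbf{P}_t$) is the uniform distribution on $[0,P_{t,\mathcal{G}}]$.
   Context: Watermarked decoder. Given a distribution $\mathbf{P}_t$ on the finite vocabulary $\mathcal{W}$ and a subset $\mathcal{G}\subseteq\mathcal{W}$ (the "green list") with $P_{t,\mathcal{G}}>0$, define the distribution $\mathbf{Q}_t$ on $\mathcal{W}$ by $Q_{t,w}=\frac{P_{t,w}}{P_{t,\mathcal{G}}}\mathbf{1}_{\{w\in\mathcal{G}\}}$. Let $p=\sum_{w\in\mathcal{W}}\min(P_{t,w},Q_{t,w})$. Given a random variable $\zeta_t\sim U[0,1]$: if $\zeta_t\le p$, the token $w_t$ is sampled from the distribution on $\mathcal{W}$ proportional to $w\mapsto\min(P_{t,w},Q_{t,w})$; if $\zeta_t>p$, the token $w_t$ is sampled from the distribution proportional to $w\mapsto\max(0,P_{t,w}-Q_{t,w})$. The randomness used in this sampling is independent of $\zeta_t$. (If $p=1$, the second case has probability zero and the choice there is irrelevant.)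 $\mathbf{P}_t$ and $\mathcal{G}$ are treated as fixed. *)

theory Defs
  imports "HOL-Probability.Probability"
begin

(* The vocabulary is the universe of the finite type 'w. *)

definition green_prob :: "'w::finite pmf \<Rightarrow> 'w set \<Rightarrow> real" where
  "green_prob P G = (\<Sum>w\<in>G. pmf P w)"

(* As the lemmas below show, the functions embedded here are probability mass functions
   whenever green_prob P G > 0, respectively whenever f is nonnegative with positive sum.
   Outside these conditions the values are unspecified. *)
definition green_pmf :: "'w::finite pmf \<Rightarrow> 'w set \<Rightarrow> 'w pmf" where
  "green_pmf P G = embed_pmf (\<lambda>w. pmf P w / green_prob P G * indicator G w)"

definition proportional_pmf :: "('w::finite \<Rightarrow> real) \<Rightarrow> 'w pmf" where
  "proportional_pmf f = embed_pmf (\<lambda>w. f w / (\<Sum>v\<in>UNIV. f v))"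

definition overlap :: "'w::finite pmf \<Rightarrow> 'w set \<Rightarrow> real" where
  "overlap P G = (\<Sum>w\<in>UNIV. min (pmf P w) (pmf (green_pmf P G) w))"

definition accept_pmf :: "'w::finite pmf \<Rightarrow> 'w set \<Rightarrow> 'w pmf" where
  "accept_pmf P G = proportional_pmf (\<lambda>w. min (pmf P w) (pmf (green_pmf P G) w))"

definition residual_pmf :: "'w::finite pmf \<Rightarrow> 'w set \<Rightarrow> 'w pmf" where
  "residual_pmf P G = proportional_pmf (\<lambda>w. max 0 (pmf P w - pmf (green_pmf P G) w))"

(* The library's indep_var requires X and Y to have the same value type; this is the same
   notion without that restriction (cf. indep_var_eq). *)
definition indep_rvs ::
    "'s measure \<Rightarrow> 'x measure \<Rightarrow> ('s \<Rightarrow> 'x) \<Rightarrow> 'y measure \<Rightarrow> ('s \<Rightarrow> 'y) \<Rightarrow> bool" where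
  "indep_rvs M S X T Y \<longleftrightarrow>
     X \<in> measurable M S \<and> Y \<in> measurable M T \<and>
     prob_space.indep_set M (sets (vimage_algebra (space M) X S))
                            (sets (vimage_algebra (space M) Y T))"

(* a and b are the samples used in the cases zeta <= p and zeta > p. Together they form the
   sampling randomness, so the pair is independent of zeta; their joint law is otherwise
   arbitrary. For p = 1 the residual weights all vanish, and the law of b is left free. *)
definition watermarked_decoder ::
    "'s measure \<Rightarrow> 'w::finite pmf \<Rightarrow> 'w set \<Rightarrow> ('s \<Rightarrow> real) \<Rightarrow> ('s \<Rightarrow> 'w) \<Rightarrow> bool" where
  "watermarked_decoder M P G \<zeta> w \<longleftrightarrow>
     (\<exists>a b. indep_rvs M borel \<zeta> (count_space UNIV) (\<lambda>x. (a x, b x)) \<and>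
        distr M (count_space UNIV) a = measure_pmf (accept_pmf P G) \<and>
        (overlap P G < 1 \<longrightarrow>
           distr M (count_space UNIV) b = measure_pmf (residual_pmf P G)) \<and>
        (\<forall>x\<in>space M. w x = (if \<zeta> x \<le> overlap P G then a x else b x)))"

definition conditional_distr :: "'s measure \<Rightarrow> 's set \<Rightarrow> ('s \<Rightarrow> real) \<Rightarrow> real measure" where
  "conditional_distr M A X = distr (uniform_measure M A) borel X"

lemma pmf_embed_finite:
  fixes f :: "'w::finite \<Rightarrow> real"
  assumes "\<And>w. 0 \<le> f w" and "(\<Sum>w\<in>UNIV. f w) = 1"
  shows "pmf (embed_pmf f) w = f w"
proof (rule pmf_embed_pmf)
  show "(\<integral>\<^sup>+ x. ennreal (f x) \<partial>count_space UNIV) = 1"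
    using assms by (simp add: nn_integral_count_space_finite sum_ennreal)
qed (use assms in auto)

lemma pmf_green_pmf:
  assumes "0 < green_prob P G"
  shows "pmf (green_pmf P G) w = pmf P w / green_prob P G * indicator G w"
proof -
  have "(\<Sum>w\<in>UNIV. pmf P w * indicator G w) = green_prob P G"
    by (simp add: green_prob_def indicator_def if_distrib sum.If_cases cong: if_cong)
  then have "(\<Sum>w\<in>UNIV. pmf P w / green_prob P G * indicator G w) = 1"
    using assms by (simp flip: sum_divide_distrib)
  then show ?thesis
    unfolding green_pmf_def using assms by (intro pmf_embed_finite) auto
qed

lemma pmf_proportional_pmf:
  assumes "\<And>w. 0 \<le> f w" and "0 < (\<Sum>v\<in>UNIV. f v)"
  shows "pmf (proportional_pmf f) w = f w / (\<Sum>v\<in>UNIV. f v)"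
  unfolding proportional_pmf_def using assms
  by (intro pmf_embed_finite) (auto simp flip: sum_divide_distrib)

end

theory Submission
  imports Defs
begin

text \<open>
  With \<open>g\<close> the green mass, the green distribution is \<open>P / g \<ge> P\<close> on \<open>G\<close> and \<open>0\<close> off
  \<open>G\<close>. Hence the overlap equals \<open>g\<close>, the accepting distribution lives on \<open>G\<close> and the
  residual one off \<open>G\<close>, so that the event that the token is green is almost surely the event
  that \<open>\<zeta> \<le> g\<close>. Conditioning the uniform distribution on this event gives the claim.
\<close>

lemma green_prob_le_1: "green_prob P G \<le> 1"
  by (metis green_prob_def finite measure_measure_pmf_finite measure_pmf.prob_le_1)

lemma pmf_le_divide_green_prob:
  assumes "0 < green_prob P G"
  shows "pmf P w \<le> pmf P w / green_prob P G"
  using assms mult_left_mono[OF green_prob_le_1 pmf_nonneg] by (simp add: le_divide_eq)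

lemma min_pmf_green_pmf:
  assumes "0 < green_prob P G"
  shows "min (pmf P w) (pmf (green_pmf P G) w) = pmf P w * indicator G w"
  using pmf_le_divide_green_prob[OF assms, of w]
  by (auto simp: pmf_green_pmf[OF assms] indicator_def min_def)

lemma max_pmf_diff_green_pmf:
  assumes "0 < green_prob P G"
  shows "max 0 (pmf P w - pmf (green_pmf P G) w) = pmf P w * indicator (- G) w"
  using pmf_le_divide_green_prob[OF assms, of w]
  by (auto simp: pmf_green_pmf[OF assms] indicator_def max_def)

lemma sum_pmf_indicator: "(\<Sum>w\<in>UNIV. pmf P w * indicator A w) = green_prob P A"
  by (simp add: green_prob_def indicator_def if_distrib sum.If_cases cong: if_cong)

lemma green_prob_Compl: "green_prob P (- G) = 1 - green_prob P G"
proof -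
  have "green_prob P G + green_prob P (- G) = (\<Sum>w\<in>UNIV. pmf P w)"
    unfolding green_prob_def by (subst sum.union_disjoint[symmetric]) (auto simp: Un_commute)
  then show ?thesis by (simp add: sum_pmf_eq_1)
qed

lemma overlap_eq_green_prob:
  assumes "0 < green_prob P G"
  shows "overlap P G = green_prob P G"
  by (simp add: overlap_def min_pmf_green_pmf[OF assms] sum_pmf_indicator)

text \<open>Dividing by a positive constant leaves the support of the weights unchanged.\<close>

lemma set_proportional_pmf:
  assumes "\<And>w. 0 \<le> f w" and "0 < (\<Sum>v\<in>UNIV. f v)"
  shows "set_pmf (proportional_pmf f) = {w. f w \<noteq> 0}"
  using assms(2) by (auto simp: set_pmf_eq pmf_proportional_pmf[OF assms])

lemma set_accept_pmf:
  assumes "0 < green_prob P G"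
  shows "set_pmf (accept_pmf P G) \<subseteq> G"
  unfolding accept_pmf_def min_pmf_green_pmf[OF assms]
  using assms by (subst set_proportional_pmf) (simp_all only: sum_pmf_indicator, auto simp: indicator_eq_0_iff)

text \<open>The residual weights sum to \<open>1 - green_prob P G\<close>, so the strict bound is
  what makes their normalisation legitimate.\<close>

lemma set_residual_pmf:
  assumes "0 < green_prob P G" "green_prob P G < 1"
  shows "set_pmf (residual_pmf P G) \<subseteq> - G"
  unfolding residual_pmf_def max_pmf_diff_green_pmf[OF assms(1)]
  using assms
  by (subst set_proportional_pmf) (simp_all only: sum_pmf_indicator green_prob_Compl, auto)

lemma AE_in_set_pmf_distr:
  assumes "X \<in> measurable M (count_space UNIV)"
    and "distr M (count_space UNIV) X = measure_pmf p" and "set_pmf p \<subseteq> A"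
  shows "AE x in M. X x \<in> A"
proof -
  have "AE y in distr M (count_space UNIV) X. y \<in> A"
    unfolding assms(2) using assms(3) by (auto simp: AE_measure_pmf_iff)
  then show ?thesis
    by (subst (asm) AE_distr_iff) (use assms(1) in auto)
qed

text \<open>Normalised restriction to \<open>A\<close> sees only the measures of \<open>A\<close>
  and of \<open>A \<inter> E\<close>, and neither changes when \<open>A\<close> is altered on a null
  set. This allows the green event to be replaced by an event about \<zeta>.\<close>

lemma conditional_distr_cong_AE:
  assumes [measurable]: "X \<in> borel_measurable M" "A \<in> sets M" "B \<in> sets M"
    and "AE x in M. x \<in> A \<longleftrightarrow> x \<in> B"
  shows "conditional_distr M A X = conditional_distr M B X"
proof -
  have "uniform_measure M A = uniform_measure M B"
  proof (rule measure_eqI)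
    fix E assume "E \<in> sets (uniform_measure M A)"
    then have [measurable]: "E \<in> sets M" by simp
    have "emeasure M A = emeasure M B"
      using assms(4) by (intro emeasure_eq_AE) auto
    moreover have "emeasure M (A \<inter> E) = emeasure M (B \<inter> E)"
      using assms(4) by (intro emeasure_eq_AE) auto
    ultimately show "emeasure (uniform_measure M A) E = emeasure (uniform_measure M B) E"
      by simp
  qed simp
  then show ?thesis by (simp add: conditional_distr_def)
qed

text \<open>Conditioning on an event determined by \<open>X\<close> commutes with passing to the law
  of \<open>X\<close>, since preimages respect intersections. The computation thus moves from
  \<open>M\<close> to the real line.\<close>

lemma conditional_distr_vimage:
  assumes [measurable]: "X \<in> borel_measurable M" "B \<in> sets borel"
  shows "conditional_distr M (X -` B \<inter> space M) X = uniform_measure (distr M borel X) B"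
proof (rule measure_eqI)
  fix E assume "E \<in> sets (conditional_distr M (X -` B \<inter> space M) X)"
  then have [measurable]: "E \<in> sets borel" by (simp add: conditional_distr_def)
  have "(X -` B \<inter> space M) \<inter> (X -` E \<inter> space M) = X -` (B \<inter> E) \<inter> space M" by auto
  then show "emeasure (conditional_distr M (X -` B \<inter> space M) X) E
      = emeasure (uniform_measure (distr M borel X) B) E"
    by (simp add: conditional_distr_def emeasure_distr)
qed (simp add: conditional_distr_def)

lemma uniform_measure_uniform_measure:
  assumes [measurable]: "A \<in> sets M" "B \<in> sets M"
    and "emeasure M A \<noteq> 0" "emeasure M A \<noteq> \<infinity>"
  shows "uniform_measure (uniform_measure M A) B = uniform_measure M (A \<inter> B)"
proof (rule measure_eqI)
  fix E assume "E \<in> sets (uniform_measure (uniform_measure M A) B)"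
  then have [measurable]: "E \<in> sets M" by simp
  \<comment> \<open>Numerator and denominator of the outer quotient both carry the factor
    \<open>inverse (emeasure M A)\<close>; it cancels in \<open>ennreal\<close> because it is
    neither zero nor infinite.\<close>
  have "inverse (emeasure M A) \<noteq> 0" "inverse (emeasure M A) \<noteq> \<infinity>"
    using assms(3,4) by simp_all
  then show "emeasure (uniform_measure (uniform_measure M A) B) E
      = emeasure (uniform_measure M (A \<inter> B)) E"
    by (simp add: Int_assoc divide_ennreal_def[of _ "emeasure M A"] divide_mult_eq)
qed simp

text \<open>The threshold is the green mass, and up to null sets the accepting branch yields only
  green tokens and the residual branch only others.\<close>

lemma watermarked_decoder_AE_green_iff:
  assumes "0 < green_prob P G"
    and [measurable]: "\<zeta> \<in> borel_measurable M"
    and \<zeta>: "distr M borel \<zeta> = uniform_measure lborel {0..1}"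
    and "watermarked_decoder M P G \<zeta> w"
  shows "w \<in> measurable M (count_space UNIV)"
    and "AE x in M. w x \<in> G \<longleftrightarrow> \<zeta> x \<le> green_prob P G"
proof -
  obtain a b where ab: "(\<lambda>x. (a x, b x)) \<in> measurable M (count_space UNIV)"
    and a: "distr M (count_space UNIV) a = measure_pmf (accept_pmf P G)"
    and b: "green_prob P G < 1 \<Longrightarrow>
      distr M (count_space UNIV) b = measure_pmf (residual_pmf P G)"
    and w: "\<And>x. x \<in> space M \<Longrightarrow> w x = (if \<zeta> x \<le> green_prob P G then a x else b x)"
    using assms(4) unfolding watermarked_decoder_def indep_rvs_def overlap_eq_green_prob[OF assms(1)]
    by blast
  have [measurable]: "a \<in> measurable M (count_space UNIV)"
    using measurable_compose[OF ab, of fst "count_space UNIV"] by simp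
  have [measurable]: "b \<in> measurable M (count_space UNIV)"
    using measurable_compose[OF ab, of snd "count_space UNIV"] by simp
  show "w \<in> measurable M (count_space UNIV)"
    by (subst measurable_cong[OF w]) auto
  have A: "AE x in M. a x \<in> G"
    using a set_accept_pmf[OF assms(1)] by (intro AE_in_set_pmf_distr) auto
  \<comment> \<open>The disjunction also covers green mass 1, where the law of \<open>b\<close> is
    unspecified.\<close>
  have B: "AE x in M. \<zeta> x \<le> green_prob P G \<or> b x \<in> - G"
  proof (cases "green_prob P G < 1")
    case True
    then have "AE x in M. b x \<in> - G"
      using b set_residual_pmf[OF assms(1)] by (intro AE_in_set_pmf_distr) auto
    then show ?thesis by auto
  next
    case False
    \<comment> \<open>Here the green mass is at least 1, so the residual branch would require
      \<zeta> to exceed 1, a null event.\<close>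
    have "AE z in distr M borel \<zeta>. z \<le> 1"
      unfolding \<zeta> by (rule AE_uniform_measureI) auto
    then have "AE x in M. \<zeta> x \<le> 1"
      by (subst (asm) AE_distr_iff) auto
    then show ?thesis using False by auto
  qed
  show "AE x in M. w x \<in> G \<longleftrightarrow> \<zeta> x \<le> green_prob P G"
    using A B AE_space by eventually_elim (auto simp: w)
qed

theorem lemma1p1:
  fixes M :: "'s measure" and P :: "'w::finite pmf" and G :: "'w set"
    and \<zeta> :: "'s \<Rightarrow> real" and w :: "'s \<Rightarrow> 'w"
  assumes "prob_space M"
    and "green_prob P G > 0"
    and "\<zeta> \<in> borel_measurable M"
    and "distr M borel \<zeta> = uniform_measure lborel {0..1}"
    and "watermarked_decoder M P G \<zeta> w"
  shows "conditional_distr M {x \<in> space M. w x \<in> G} \<zeta>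
       = uniform_measure lborel {0..green_prob P G}"
proof -
  let ?g = "green_prob P G"
  note [measurable] = assms(3) watermarked_decoder_AE_green_iff(1)[OF assms(2-5)]
  have "conditional_distr M {x \<in> space M. w x \<in> G} \<zeta>
      = conditional_distr M (\<zeta> -` {..?g} \<inter> space M) \<zeta>"
    using watermarked_decoder_AE_green_iff(2)[OF assms(2-5)]
    by (intro conditional_distr_cong_AE) auto
  also have "\<dots> = uniform_measure (uniform_measure lborel {0..1}) {..?g}"
    by (simp add: conditional_distr_vimage assms(3,4))
  also have "\<dots> = uniform_measure lborel ({0..1} \<inter> {..?g})"
    by (rule uniform_measure_uniform_measure) auto
  \<comment> \<open>The green mass is at most 1, so the unit interval does not cut off
    \<open>{0..?g}\<close>.\<close>
  also have "{0..1} \<inter> {..?g} = {0..?g}"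
    using green_prob_le_1[of P G] by auto
  finally show ?thesis .
qed

end
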